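(* Consider the plant $x_{k+1}=A_px_k+B_pu_k$, $y_k=C_px_k$ with $x_k\in\mathbb{R}^n$, $u_k\in\mathbb{R}^m$, $y_k\in\mathbb{R}^p$, in feedback with a static implicit neural controller $$\eta_k=\phi(W\eta_k+Uy_k+b),\qquad u_k=Ky_k+V\eta_k+d,\qquad\eta_k\in\mathbb{R}^q,$$ with parameters $\theta=(W,U,V,K,b,d)$, where $\phi$ is componentwise nonexpansive and satisfies the static sector condition with diagonal matrices $D_0,D_1$. Suppose the training loop (the procedure used to choose $\theta$) returns parameters $\theta$ satisfying $\lambda_{\mathrm{pf}}(|W|)<1$. (i) If, for the resulting closed loop, there exist $P\succ0$, a diagonal $\Lambda\succeq0$ and $\rho\in[0,1)$ such that $$F^\top PF-\rho^2X^\top PX+M_\Lambda\preceq0,$$ then the returned controller is well posed and exponentially stabilizing. (ii) Let $Q\succeq0$, $R\succeq0$, $\beta\in(0,1]$. If, for the resulting closed loop, there exist $P\succ0$ and a diagonal $\Lambda\succeq0$ such that $$\beta F^\top PF-X^\top PX+X^\top QX+G^\top RG+M_\Lambda\preceq0,$$ then the returned controller is well posed and satisfies the discounted-performance bound: every closed-loop trajectory satisfies $$\sum_{k=0}^\infty\beta^k\left(x_k^\top Qx_k+u_k^\top Ru_k\right)\le x_0^\top Px_0.$$ These guarantees are independent of the optimizer used to obtain $\theta$.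
   Context: Well posed: for every $c\in\mathbb{R}^q$ the equation $\eta=\phi(W\eta+c)$ has a unique solution. Exponentially stabilizing: the origin of the closed loop is globally exponentially stable; more precisely $x_k^\top Px_k\le\rho^{2k}x_0^\top Px_0$ for all $k\ge0$. Componentwise nonexpansive: $\phi:\mathbb{R}^q\to\mathbb{R}^q$ acts componentwise, $\phi(r)_i=\phi_i(r_i)$, and $|\phi(r)-\phi(s)|\le|r-s|$ for all $r,s\in\mathbb{R}^q$, with componentwise absolute values and inequalities. Static sector condition: $\phi(0)=0$ and there are diagonal matrices $D_0=\mathrm{diag}(\underline m_i)$, $D_1=\mathrm{diag}(\overline m_i)$ with $0\le\underline m_i\le\overline m_i\le1$ such that $(\phi_i(z_i)-\underline m_iz_i)(\overline m_iz_i-\phi_i(z_i))\ge0$ for all $z_i\in\mathbb{R}$, $i=1,\dots,q$. Notation: $X=[I_n\;\;0]\in\mathbb{R}^{n\times(n+q)}$, $H=[0\;\;I_q]\in\mathbb{R}^{q\times(n+q)}$, $Z=[UC_p\;\;W]$, $F=[A_p+B_pKC_p\;\;B_pV]$, $G=[KC_p\;\;V]$, and $$M_\Lambda=-2Z^\top D_0\Lambda D_1Z+\mathrm{He}\big(H^\top\Lambda(D_0+D_1)Z\big)-2H^\top\Lambda H,\qquad\mathrm{He}(Y)=Y+Y^\top.$$ $P\in\mathbb{R}^{n\times n}$, $\Lambda\in\mathbb{R}^{q\times q}$; $P\succ0$ means symmetric positive definite; $\preceq,\succeq$ denote the semidefinite order; $|W|$ is the componentwise absolute value; $\lambda_{\mathrm{pf}}(|W|)$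 is the Perron--Frobenius eigenvalue (spectral radius) of the nonnegative matrix $|W|$. All matrices and vectors are real of compatible dimensions.
   Formalization: The stability and discounted-performance conclusions are stated only for zero biases b = 0, d = 0, since with nonzero biases (e.g. A_p=0, B_p=1, C_p=W=U=V=K=0, d=1, x_0=0) both claims fail; well-posedness is kept for arbitrary biases. *)

theory Defs
  imports "HOL-Analysis.Analysis"
begin

section \<open>Matrices\<close>

text \<open>
  On vectors and matrices over the reals, the library's \<open>\<bar>_\<bar>\<close> and \<open>\<le>\<close> are the componentwise
  absolute value and order.
\<close>

lemma abs_matrix_nth: "\<bar>A::real^'n^'m\<bar> $ i $ j = \<bar>A $ i $ j\<bar>"
  by (simp add: abs_vec_def)

definition diagonal :: "real^'n^'n \<Rightarrow> bool" where
  "diagonal A \<longleftrightarrow> (\<forall>i j. i \<noteq> j \<longrightarrow> A $ i $ j = 0)"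

definition pos_def :: "real^'n^'n \<Rightarrow> bool" where
  "pos_def A \<longleftrightarrow> transpose A = A \<and> (\<forall>v. v \<noteq> 0 \<longrightarrow> v \<bullet> (A *v v) > 0)"

definition pos_semidef :: "real^'n^'n \<Rightarrow> bool" where
  "pos_semidef A \<longleftrightarrow> transpose A = A \<and> (\<forall>v. v \<bullet> (A *v v) \<ge> 0)"

definition loewner_le :: "real^'n^'n \<Rightarrow> real^'n^'n \<Rightarrow> bool"  (infix "\<preceq>\<^sub>L" 50) where
  "A \<preceq>\<^sub>L B \<longleftrightarrow> pos_semidef (B - A)"

text \<open>The spectrum is the complex one, although the matrix is real.\<close>

definition eigenvalues :: "real^'n^'n \<Rightarrow> complex set" where
  "eigenvalues A =
     {z. \<exists>v::complex^'n. v \<noteq> 0 \<and> (\<chi> i j. complex_of_real (A $ i $ j)) *v v = z *s v}"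

definition spectral_radius :: "real^'n^'n \<Rightarrow> real" where
  "spectral_radius A = Sup (cmod ` eigenvalues A)"

text \<open>\<open>hcat A B\<close> is the block row \<open>[A B]\<close>; the columns are indexed by the disjoint sum.\<close>

definition hcat :: "real^'a^'r \<Rightarrow> real^'b^'r \<Rightarrow> real^('a + 'b)^'r" where
  "hcat A B = (\<chi> i j. case j of Inl a \<Rightarrow> A $ i $ a | Inr b \<Rightarrow> B $ i $ b)"

definition He :: "real^'n^'n \<Rightarrow> real^'n^'n" where
  "He Y = Y + transpose Y"

section \<open>Activation functions\<close>

text \<open>
  \<open>\<phi>\<close> is the vector map and \<open>f i\<close> its \<open>i\<close>-th scalar component.
\<close>

definition acts_componentwise :: "(real^'q \<Rightarrow> real^'q) \<Rightarrow> ('q \<Rightarrow> real \<Rightarrow> real) \<Rightarrow> bool" where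
  "acts_componentwise \<phi> f \<longleftrightarrow> (\<forall>r i. \<phi> r $ i = f i (r $ i))"

definition componentwise_nonexpansive ::
    "(real^'q \<Rightarrow> real^'q) \<Rightarrow> ('q \<Rightarrow> real \<Rightarrow> real) \<Rightarrow> bool" where
  "componentwise_nonexpansive \<phi> f \<longleftrightarrow>
     acts_componentwise \<phi> f \<and> (\<forall>r s. \<bar>\<phi> r - \<phi> s\<bar> \<le> \<bar>r - s\<bar>)"

definition static_sector ::
    "(real^'q \<Rightarrow> real^'q) \<Rightarrow> ('q \<Rightarrow> real \<Rightarrow> real) \<Rightarrow> real^'q^'q \<Rightarrow> real^'q^'q \<Rightarrow> bool" where
  "static_sector \<phi> f D0 D1 \<longleftrightarrow>
     \<phi> 0 = 0 \<and> diagonal D0 \<and> diagonal D1 \<and>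
     (\<forall>i. 0 \<le> D0 $ i $ i \<and> D0 $ i $ i \<le> D1 $ i $ i \<and> D1 $ i $ i \<le> 1) \<and>
     (\<forall>i z. (f i z - D0 $ i $ i * z) * (D1 $ i $ i * z - f i z) \<ge> 0)"

section \<open>Closed loop\<close>

definition well_posed :: "(real^'q \<Rightarrow> real^'q) \<Rightarrow> real^'q^'q \<Rightarrow> bool" where
  "well_posed \<phi> W \<longleftrightarrow> (\<forall>c. \<exists>!\<eta>. \<eta> = \<phi> (W *v \<eta> + c))"

definition closed_loop ::
    "real^'n^'n \<Rightarrow> real^'m^'n \<Rightarrow> real^'n^'p \<Rightarrow> (real^'q \<Rightarrow> real^'q) \<Rightarrow>
     real^'q^'q \<Rightarrow> real^'p^'q \<Rightarrow> real^'q^'m \<Rightarrow> real^'p^'m \<Rightarrow> real^'q \<Rightarrow> real^'m \<Rightarrow>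
     (nat \<Rightarrow> real^'n) \<Rightarrow> (nat \<Rightarrow> real^'m) \<Rightarrow> (nat \<Rightarrow> real^'p) \<Rightarrow> (nat \<Rightarrow> real^'q) \<Rightarrow> bool" where
  "closed_loop Ap Bp Cp \<phi> W U V K b d x u y \<eta> \<longleftrightarrow>
     (\<forall>k. x (Suc k) = Ap *v x k + Bp *v u k \<and>
          y k = Cp *v x k \<and>
          \<eta> k = \<phi> (W *v \<eta> k + U *v y k + b) \<and>
          u k = K *v y k + V *v \<eta> k + d)"

text \<open>
  Global exponential stability of the origin, together with the quantitative decay
  \<open>x\<^sub>k\<^sup>T P x\<^sub>k \<le> \<rho>\<^sup>2\<^sup>k x\<^sub>0\<^sup>T P x\<^sub>0\<close> of the certificate.
\<close>

definition exponentially_stabilizing ::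
    "real^'n^'n \<Rightarrow> real^'m^'n \<Rightarrow> real^'n^'p \<Rightarrow> (real^'q \<Rightarrow> real^'q) \<Rightarrow>
     real^'q^'q \<Rightarrow> real^'p^'q \<Rightarrow> real^'q^'m \<Rightarrow> real^'p^'m \<Rightarrow> real^'q \<Rightarrow> real^'m \<Rightarrow>
     real^'n^'n \<Rightarrow> real \<Rightarrow> bool" where
  "exponentially_stabilizing Ap Bp Cp \<phi> W U V K b d P \<rho> \<longleftrightarrow>
     (\<exists>c r. c \<ge> 0 \<and> 0 \<le> r \<and> r < 1 \<and>
        (\<forall>x u y \<eta>. closed_loop Ap Bp Cp \<phi> W U V K b d x u y \<eta> \<longrightarrow>
           (\<forall>k. norm (x k) \<le> c * r ^ k * norm (x 0)))) \<and>
     (\<forall>x u y \<eta>. closed_loop Ap Bp Cp \<phi> W U V K b d x u y \<eta> \<longrightarrow>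
        (\<forall>k. x k \<bullet> (P *v x k) \<le> \<rho> ^ (2 * k) * (x 0 \<bullet> (P *v x 0))))"

text \<open>
  The discounted series is required to converge: \<open>suminf\<close> alone is unspecified on divergent series.
\<close>

definition discounted_performance ::
    "real^'n^'n \<Rightarrow> real^'m^'n \<Rightarrow> real^'n^'p \<Rightarrow> (real^'q \<Rightarrow> real^'q) \<Rightarrow>
     real^'q^'q \<Rightarrow> real^'p^'q \<Rightarrow> real^'q^'m \<Rightarrow> real^'p^'m \<Rightarrow> real^'q \<Rightarrow> real^'m \<Rightarrow>
     real^'n^'n \<Rightarrow> real^'m^'m \<Rightarrow> real \<Rightarrow> real^'n^'n \<Rightarrow> bool" where
  "discounted_performance Ap Bp Cp \<phi> W U V K b d Q R \<beta> P \<longleftrightarrow>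
     (\<forall>x u y \<eta>. closed_loop Ap Bp Cp \<phi> W U V K b d x u y \<eta> \<longrightarrow>
        summable (\<lambda>k. \<beta> ^ k * (x k \<bullet> (Q *v x k) + u k \<bullet> (R *v u k))) \<and>
        (\<Sum>k. \<beta> ^ k * (x k \<bullet> (Q *v x k) + u k \<bullet> (R *v u k))) \<le> x 0 \<bullet> (P *v x 0))"

section \<open>Certificate matrices\<close>

definition Xmat :: "real^('n::finite + 'q::finite)^'n" where
  "Xmat = hcat (mat 1) 0"

definition Hmat :: "real^('n::finite + 'q::finite)^'q" where
  "Hmat = hcat 0 (mat 1)"

definition Zmat :: "real^'n^'p \<Rightarrow> real^'q^'q \<Rightarrow> real^'p^'q \<Rightarrow> real^('n + 'q)^'q" where
  "Zmat Cp W U = hcat (U ** Cp) W"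

definition Fmat :: "real^'n^'n \<Rightarrow> real^'m^'n \<Rightarrow> real^'n^'p \<Rightarrow> real^'q^'m \<Rightarrow> real^'p^'m \<Rightarrow>
    real^('n + 'q)^'n" where
  "Fmat Ap Bp Cp V K = hcat (Ap + Bp ** K ** Cp) (Bp ** V)"

definition Gmat :: "real^'n^'p \<Rightarrow> real^'q^'m \<Rightarrow> real^'p^'m \<Rightarrow> real^('n + 'q)^'m" where
  "Gmat Cp V K = hcat (K ** Cp) V"

definition Mmat :: "real^'n^'p \<Rightarrow> real^'q^'q \<Rightarrow> real^'p^'q \<Rightarrow> real^'q^'q \<Rightarrow> real^'q^'q \<Rightarrow>
    real^'q^'q \<Rightarrow> real^('n + 'q)^('n + 'q)" where
  "Mmat Cp W U D0 D1 L =
     (let Z = Zmat Cp W U; H = Hmat in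
        - (2 *\<^sub>R (transpose Z ** D0 ** L ** D1 ** Z))
        + He (transpose H ** L ** (D0 + D1) ** Z)
        - 2 *\<^sub>R (transpose H ** L ** H))"

end

theory Submission
  imports Defs
begin

text \<open>
  If \<open>\<lambda>\<^sub>p\<^sub>f(|W|) < 1\<close>, then \<open>v = 1 + |W| v\<close> has a solution with entries at least \<open>1\<close>. Nonexpansiveness
  makes \<open>\<eta> \<mapsto> \<phi>(W \<eta> + c)\<close> map every large box \<open>|\<eta>| \<le> R v\<close> into itself, so Brouwer gives a fixed
  point. The difference \<open>e\<close> of two fixed points satisfies \<open>|e| \<le> |W| |e|\<close>, and comparing \<open>|e|\<close> with \<open>v\<close>
  at an index where \<open>|e\<^sub>i| / v\<^sub>i\<close> is largest gives \<open>e = 0\<close>. Along the closed loop the sector condition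
  makes the quadratic form of \<open>M\<^sub>\<Lambda>\<close> nonnegative at \<open>(x\<^sub>k, \<eta>\<^sub>k)\<close>, so the matrix inequalities become
  one-step dissipation inequalities for \<open>x\<^sup>T P x\<close>.
\<close>

section \<open>Nonnegative matrices with spectral radius below one\<close>

lemma ex_max_index:
  fixes g :: "'n::finite \<Rightarrow> real"
  obtains i where "\<And>j. g j \<le> g i"
proof -
  have "Max (range g) \<in> range g" by (rule Max_in) auto
  then obtain i where "Max (range g) = g i" by blast
  then show ?thesis using that Max_ge[of "range g"] by (metis finite finite_imageI rangeI)
qed

text \<open>Makes the supremum in \<open>spectral_radius\<close> a genuine upper bound. The
  eigenvalue equation, read in a row where the eigenvector has its largest modulus, bounds the
  eigenvalue by the absolute row sum.\<close>

lemma bdd_above_eigenvalues: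
  fixes A :: "real^'n^'n"
  shows "bdd_above (cmod ` eigenvalues A)"
proof (rule bdd_aboveI2)
  fix z assume "z \<in> eigenvalues A"
  then obtain v :: "complex^'n" where v: "v \<noteq> 0"
    and ev: "(\<chi> i j. complex_of_real (A $ i $ j)) *v v = z *s v"
    by (auto simp: eigenvalues_def)
  obtain i where i: "\<And>j. cmod (v $ j) \<le> cmod (v $ i)"
    using ex_max_index[of "\<lambda>i. cmod (v $ i)"] by blast
  obtain j where "v $ j \<noteq> 0" using v by (auto simp: vec_eq_iff)
  then have pos: "cmod (v $ i) > 0" using i[of j] by (smt (verit) zero_less_norm_iff)
  have "cmod z * cmod (v $ i) = cmod (\<Sum>j\<in>UNIV. complex_of_real (A $ i $ j) * v $ j)"
    using arg_cong[OF ev, of "\<lambda>w. cmod (w $ i)"]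
    by (simp add: matrix_vector_mult_def norm_mult)
  also have "\<dots> \<le> (\<Sum>j\<in>UNIV. \<bar>A $ i $ j\<bar> * cmod (v $ i))"
    by (rule sum_norm_le) (simp add: norm_mult mult_left_mono i)
  also have "\<dots> = (\<Sum>j\<in>UNIV. \<bar>A $ i $ j\<bar>) * cmod (v $ i)"
    by (simp add: sum_distrib_right)
  finally have "cmod z \<le> (\<Sum>j\<in>UNIV. \<bar>A $ i $ j\<bar>)" using pos by simp
  \<comment> \<open>The row \<open>i\<close> depends on the eigenvector, so its sum is enlarged to a
    bound common to all eigenvalues.\<close>
  also have "\<dots> \<le> (\<Sum>i\<in>UNIV. \<Sum>j\<in>UNIV. \<bar>A $ i $ j\<bar>)"
    by (rule member_le_sum[of i UNIV "\<lambda>i. \<Sum>j\<in>UNIV. \<bar>A $ i $ j\<bar>"]) (auto intro: sum_nonneg)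
  finally show "cmod z \<le> (\<Sum>i\<in>UNIV. \<Sum>j\<in>UNIV. \<bar>A $ i $ j\<bar>)" .
qed

lemma real_eigenvalue_le_spectral_radius:
  fixes A :: "real^'n^'n"
  assumes "x \<noteq> 0" "A *v x = r *\<^sub>R x"
  shows "\<bar>r\<bar> \<le> spectral_radius A"
proof -
  define v :: "complex^'n" where "v = (\<chi> i. complex_of_real (x $ i))"
  have "v \<noteq> 0" using assms(1) by (auto simp: v_def vec_eq_iff)
  moreover have "(\<chi> i j. complex_of_real (A $ i $ j)) *v v = complex_of_real r *s v"
  proof (subst vec_eq_iff, rule allI)
    fix i
    have "(\<Sum>j\<in>UNIV. A $ i $ j * x $ j) = r * x $ i"
      using arg_cong[OF assms(2), of "\<lambda>w. w $ i"] by (simp add: matrix_vector_mult_def)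
    then show "((\<chi> i j. complex_of_real (A $ i $ j)) *v v) $ i = (complex_of_real r *s v) $ i"
      by (simp add: matrix_vector_mult_def v_def flip: of_real_mult of_real_sum)
  qed
  ultimately have "complex_of_real r \<in> eigenvalues A" by (auto simp: eigenvalues_def)
  then show ?thesis
    unfolding spectral_radius_def
    using cSup_upper[OF _ bdd_above_eigenvalues, of "cmod (complex_of_real r)" A] by force
qed

text \<open>A nonzero kernel vector would be an eigenvector of \<open>A\<close> for
  \<open>1 / t\<close>, which is at least 1 and so exceeds the spectral radius; at
  \<open>t = 0\<close> the kernel is trivial.\<close>

lemma det_one_minus_scaled_nonzero:
  fixes A :: "real^'n^'n"
  assumes "spectral_radius A < 1" "0 \<le> t" "t \<le> 1"
  shows "det (mat 1 - t *\<^sub>R A) \<noteq> 0"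
proof
  assume "det (mat 1 - t *\<^sub>R A) = 0"
  then obtain x where x: "x \<noteq> 0" "(mat 1 - t *\<^sub>R A) *v x = 0"
    by (metis invertible_det_nz invertible_left_inverse matrix_left_invertible_ker)
  then have eq: "x = t *\<^sub>R (A *v x)"
    by (simp add: matrix_vector_mult_diff_rdistrib scaleR_matrix_vector_assoc)
  with x(1) have t: "t > 0" using assms(2) by (cases "t = 0") auto
  then have "A *v x = (1 / t) *\<^sub>R x"
    using arg_cong[OF eq, of "\<lambda>w. (1 / t) *\<^sub>R w"] by simp
  from real_eigenvalue_le_spectral_radius[OF x(1) this] have "\<bar>1 / t\<bar> < 1"
    using assms(1) by (rule le_less_trans)
  then show False using t assms(3) by simp
qed

text \<open>
  The solution \<open>v(t)\<close> of \<open>v = 1 + t A v\<close> exists and is continuous for \<open>t \<in> [0,1]\<close>. If it is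
  positive then it is already at least \<open>1\<close>, so positivity is an open and closed condition on \<open>t\<close>.
\<close>

lemma spectral_radius_less_one_imp_supersolution:
  fixes A :: "real^'n^'n"
  assumes nonneg: "\<And>i j. 0 \<le> A $ i $ j" and sr: "spectral_radius A < 1"
  obtains v where "\<And>i. 1 \<le> v $ i" "v = 1 + A *v v"
proof -
  let ?B = "\<lambda>t. mat 1 - t *\<^sub>R A"
  \<comment> \<open>Cramer's rule writes the solution as a quotient of determinants, from which
    continuity in \<open>t\<close> can be read off.\<close>
  define v :: "real \<Rightarrow> real^'n" where
    "v t = (\<chi> k. det (\<chi> i j. if j = k then (1::real^'n) $ i else ?B t $ i $ j) / det (?B t))" for t
  have v_eq: "v t = 1 + t *\<^sub>R (A *v v t)" if "t \<in> {0..1}" for t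
  proof -
    have "det (?B t) \<noteq> 0" using det_one_minus_scaled_nonzero[OF sr] that by auto
    from cramer[OF this, of "v t" 1] have "?B t *v v t = 1" by (simp add: v_def)
    then show ?thesis
      by (simp add: matrix_vector_mult_diff_rdistrib scaleR_matrix_vector_assoc algebra_simps)
  qed
  have cont: "continuous_on {0..1} (\<lambda>t. v t $ i)" for i
    unfolding v_def vec_lambda_beta
  proof (rule continuous_on_divide)
    show "continuous_on {0..1} (\<lambda>t. det (?B t))"
      unfolding det_def by (simp, intro continuous_intros)
    show "continuous_on {0..1}
        (\<lambda>t. det (\<chi> k j. if j = i then (1::real^'n) $ k else ?B t $ k $ j))"
      unfolding det_def vec_lambda_beta
      apply (intro continuous_intros)
      \<comment> \<open>Column \<open>i\<close> holds the constant right-hand side; all other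
        entries are affine in \<open>t\<close>.\<close>
      subgoal for p x by (cases "p x = i") (auto intro!: continuous_intros)
      done
    show "\<forall>t\<in>{0..1}. det (?B t) \<noteq> 0"
      using det_one_minus_scaled_nonzero[OF sr] by auto
  qed
  have ge1: "1 \<le> v t $ i" if t: "t \<in> {0..1}" and pos: "\<And>j. 0 < v t $ j" for t i
  proof -
    have "0 \<le> t * (\<Sum>j\<in>UNIV. A $ i $ j * v t $ j)"
      using t nonneg pos by (intro mult_nonneg_nonneg sum_nonneg) (auto intro: less_imp_le)
    moreover have "v t $ i = 1 + t * (\<Sum>j\<in>UNIV. A $ i $ j * v t $ j)"
      using arg_cong[OF v_eq[OF t], of "\<lambda>w. w $ i"] by (simp add: matrix_vector_mult_def)
    ultimately show ?thesis by simp
  qed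
  define S where "S = {t\<in>{0..1}. \<forall>i. 0 < v t $ i}"
  have S_ge: "S = {t\<in>{0..1}. \<forall>i. 1 \<le> v t $ i}"
    unfolding S_def using ge1 by (auto intro: less_le_trans[OF zero_less_one])
  have "openin (top_of_set {0..1}) (\<Inter>i. {0..1} \<inter> (\<lambda>t. v t $ i) -` {0<..})"
    by (intro openin_Inter) (auto intro!: continuous_openin_preimage_gen[OF cont])
  moreover have "(\<Inter>i. {0..1} \<inter> (\<lambda>t. v t $ i) -` {0<..}) = S" by (auto simp: S_def)
  ultimately have S_open: "openin (top_of_set {0..1}) S" by metis
  have "closedin (top_of_set {0..1}) (\<Inter>i. {0..1} \<inter> (\<lambda>t. v t $ i) -` {1..})"
    by (intro closedin_Inter) (auto intro!: continuous_closedin_preimage[OF cont])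
  moreover have "(\<Inter>i. {0..1} \<inter> (\<lambda>t. v t $ i) -` {1..}) = S" by (auto simp: S_ge)
  ultimately have S_closed: "closedin (top_of_set {0..1}) S" by metis
  have "0 \<in> S" using v_eq[of 0] by (simp add: S_def)
  then have "S = {0..1}"
    using connected_clopen[of "{0..1::real}"] S_open S_closed connected_Icc by blast
  then have "1 \<in> S" by simp
  then show ?thesis using that[of "v 1"] v_eq[of 1] by (auto simp: S_ge)
qed

section \<open>Well-posedness\<close>

text \<open>With \<open>m\<close> the largest ratio \<open>e $ i / v $ i\<close>, the vector
  \<open>e\<close> lies below \<open>m v\<close> and meets it at the maximal index. There
  \<open>m * v $ i\<close> is at most \<open>m\<close> times
  \<open>(A *v v) $ i = v $ i - 1\<close>, which forces \<open>m \<le> 0\<close>.\<close>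

lemma nonneg_matrix_subsolution_eq_zero:
  fixes A :: "real^'n^'n" and e v :: "real^'n"
  assumes nonneg: "\<And>i j. 0 \<le> A $ i $ j"
    and v: "\<And>i. 1 \<le> v $ i" "v = 1 + A *v v"
    and e: "\<And>i. 0 \<le> e $ i" "\<And>i. e $ i \<le> (A *v e) $ i"
  shows "e = 0"
proof -
  obtain i where i: "\<And>j. e $ j / v $ j \<le> e $ i / v $ i"
    using ex_max_index[of "\<lambda>i. e $ i / v $ i"] by blast
  define m where "m = e $ i / v $ i"
  have v_pos: "0 < v $ j" for j using v(1)[of j] by simp
  have e_le: "e $ j \<le> m * v $ j" for j
    using i[of j] v_pos[of j] unfolding m_def[symmetric] by (simp add: pos_divide_le_eq)
  have "m * v $ i = e $ i" using v_pos[of i] by (simp add: m_def)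
  also have "\<dots> \<le> (\<Sum>j\<in>UNIV. A $ i $ j * e $ j)"
    using e(2)[of i] by (simp add: matrix_vector_mult_def)
  also have "\<dots> \<le> (\<Sum>j\<in>UNIV. A $ i $ j * (m * v $ j))"
    by (intro sum_mono mult_left_mono e_le nonneg)
  also have "\<dots> = m * (\<Sum>j\<in>UNIV. A $ i $ j * v $ j)"
    by (simp add: sum_distrib_left algebra_simps)
  also have "(\<Sum>j\<in>UNIV. A $ i $ j * v $ j) = v $ i - 1"
    using arg_cong[OF v(2), of "\<lambda>w. w $ i"] by (simp add: matrix_vector_mult_def)
  finally have "m \<le> 0" by (simp add: algebra_simps)
  have "e $ j = 0" for j
    using e_le[of j] e(1)[of j] mult_nonpos_nonneg[OF \<open>m \<le> 0\<close>, of "v $ j"] v_pos[of j] by linarith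
  then show ?thesis by (simp add: vec_eq_iff)
qed

lemma abs_matrix_vector_mult_le:
  fixes A :: "real^'n^'m"
  shows "\<bar>(A *v x) $ i\<bar> \<le> (\<bar>A\<bar> *v \<bar>x\<bar>) $ i"
  unfolding matrix_vector_mult_def vec_lambda_beta
  by (rule order_trans[OF sum_abs]) (simp add: abs_vec_def abs_mult)

lemma well_posed_if_spectral_radius_less_one:
  fixes W :: "real^'q^'q"
  assumes ne: "componentwise_nonexpansive \<phi> f" and sr: "spectral_radius \<bar>W\<bar> < 1"
  shows "well_posed \<phi> W"
  unfolding well_posed_def
proof
  fix c :: "real^'q"
  let ?T = "\<lambda>\<eta>. \<phi> (W *v \<eta> + c)"
  have W_nonneg: "0 \<le> \<bar>W\<bar> $ i $ j" for i j by (simp add: abs_matrix_nth)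
  obtain v where v: "\<And>i. 1 \<le> v $ i" "v = 1 + \<bar>W\<bar> *v v"
    using spectral_radius_less_one_imp_supersolution[OF W_nonneg sr] by blast
  have \<phi>_ne: "\<bar>\<phi> r $ i - \<phi> s $ i\<bar> \<le> \<bar>r $ i - s $ i\<bar>" for r s i
    using ne by (auto simp: componentwise_nonexpansive_def less_eq_vec_def abs_vec_def)
  have T_lip: "\<bar>?T \<eta> $ i - ?T \<zeta> $ i\<bar> \<le> (\<bar>W\<bar> *v \<bar>\<eta> - \<zeta>\<bar>) $ i" for \<eta> \<zeta> i
    using \<phi>_ne[of "W *v \<eta> + c" i "W *v \<zeta> + c"] abs_matrix_vector_mult_le[of W "\<eta> - \<zeta>" i]
    by (simp add: matrix_vector_mult_diff_distrib)
  \<comment> \<open>\<open>R\<close> only has to dominate the entries of \<open>?T 0\<close>. The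
    summand 1 in the equation for \<open>v\<close> absorbs this offset:
    \<open>R (v - 1) + R = R v\<close>.\<close>
  define R where "R = (\<Sum>i\<in>UNIV. \<bar>?T 0 $ i\<bar>)"
  have R: "\<bar>?T 0 $ i\<bar> \<le> R" for i
    unfolding R_def by (rule member_le_sum) auto
  have "0 \<le> R" by (simp add: R_def sum_nonneg)
  let ?S = "cbox (- (R *\<^sub>R v)) (R *\<^sub>R v)"
  have S_iff: "\<eta> \<in> ?S \<longleftrightarrow> (\<forall>i. \<bar>\<eta> $ i\<bar> \<le> R * v $ i)" for \<eta>
    by (auto simp: mem_box_cart abs_le_iff) (smt (verit))+
  have T_into: "?T ` ?S \<subseteq> ?S"
  proof (intro subsetI, unfold S_iff, elim imageE, intro allI)
    fix \<xi> \<eta> i assume \<xi>: "\<xi> = ?T \<eta>" and "\<eta> \<in> ?S"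
    then have \<eta>: "\<forall>i. \<bar>\<eta> $ i\<bar> \<le> R * v $ i" using S_iff[of \<eta>] by blast
    have "\<bar>?T \<eta> $ i\<bar> \<le> (\<bar>W\<bar> *v \<bar>\<eta>\<bar>) $ i + R"
      using T_lip[of \<eta> i 0] R[of i] by simp
    also have "(\<bar>W\<bar> *v \<bar>\<eta>\<bar>) $ i \<le> (\<Sum>j\<in>UNIV. \<bar>W\<bar> $ i $ j * (R * v $ j))"
      unfolding matrix_vector_mult_def vec_lambda_beta
      by (intro sum_mono mult_left_mono W_nonneg) (use \<eta> in \<open>auto simp: abs_vec_def\<close>)
    also have "\<dots> = R * (\<Sum>j\<in>UNIV. \<bar>W\<bar> $ i $ j * v $ j)"
      by (simp add: sum_distrib_left algebra_simps)
    also have "(\<Sum>j\<in>UNIV. \<bar>W\<bar> $ i $ j * v $ j) = v $ i - 1"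
      using arg_cong[OF v(2), of "\<lambda>w. w $ i"] by (simp add: matrix_vector_mult_def)
    finally show "\<bar>\<xi> $ i\<bar> \<le> R * v $ i" by (simp add: \<xi> algebra_simps)
  qed
  \<comment> \<open>Componentwise nonexpansiveness carries over to the Euclidean norm and gives the
    continuity that Brouwer's theorem requires.\<close>
  have "norm (\<phi> r - \<phi> s) \<le> norm (r - s)" for r s
    by (rule norm_le_componentwise_cart) (use \<phi>_ne in auto)
  then have "1-lipschitz_on UNIV \<phi>" by (intro lipschitz_onI) (auto simp: dist_norm)
  then have "continuous_on UNIV \<phi>" by (rule lipschitz_on_continuous_on)
  then have "continuous_on ?S ?T"
    by (rule continuous_on_compose2) (auto intro!: continuous_intros)
  moreover have "?S \<noteq> {}" using S_iff[of 0] v(1) \<open>0 \<le> R\<close>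
    by (metis abs_zero empty_iff mult_nonneg_nonneg order_trans zero_index zero_le_one)
  ultimately obtain \<eta> where \<eta>: "?T \<eta> = \<eta>"
    using brouwer[OF compact_cbox convex_box(1), of _ _ ?T] T_into by blast
  show "\<exists>!\<eta>. \<eta> = ?T \<eta>"
  proof (rule ex1I[of _ \<eta>])
    fix \<zeta> assume \<zeta>: "\<zeta> = ?T \<zeta>"
    have "\<bar>\<zeta> - \<eta>\<bar> = 0"
    proof (rule nonneg_matrix_subsolution_eq_zero[OF W_nonneg v])
      show "0 \<le> \<bar>\<zeta> - \<eta>\<bar> $ i" for i by (simp add: abs_vec_def)
      show "\<bar>\<zeta> - \<eta>\<bar> $ i \<le> (\<bar>W\<bar> *v \<bar>\<zeta> - \<eta>\<bar>) $ i" for i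
        using T_lip[of \<zeta> i \<eta>] \<zeta> \<eta> by (simp add: abs_vec_def)
    qed
    then show "\<zeta> = \<eta>" by (simp add: abs_vec_def vec_eq_iff)
  qed (simp add: \<eta>)
qed

section \<open>Quadratic forms\<close>

text \<open>The form attains a positive minimum and a maximum on the compact unit sphere;
  homogeneity of degree two carries both to all vectors.\<close>

lemma pos_def_bounds:
  fixes P :: "real^'n^'n"
  assumes "pos_def P"
  obtains a B where "0 < a" "0 < B" "\<And>x. a * (norm x)\<^sup>2 \<le> x \<bullet> (P *v x)"
    "\<And>x. x \<bullet> (P *v x) \<le> B * (norm x)\<^sup>2"
proof -
  let ?g = "\<lambda>x. x \<bullet> (P *v x)"
  have cont: "continuous_on (sphere 0 1) ?g" by (intro continuous_intros)
  have ne: "sphere (0::real^'n) 1 \<noteq> {}" by simp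
  obtain s where s: "s \<in> sphere 0 1" "\<And>x. x \<in> sphere 0 1 \<Longrightarrow> ?g s \<le> ?g x"
    using continuous_attains_inf[OF compact_sphere ne cont] by blast
  obtain S where S: "S \<in> sphere 0 1" "\<And>x. x \<in> sphere 0 1 \<Longrightarrow> ?g x \<le> ?g S"
    using continuous_attains_sup[OF compact_sphere ne cont] by blast
  have pos: "0 < ?g x" if "x \<in> sphere 0 1" for x
    using assms that unfolding pos_def_def by (metis norm_zero mem_sphere_0 zero_neq_one)
  have scale: "?g x = (norm x)\<^sup>2 * ?g (x /\<^sub>R norm x)" for x
    by (cases "x = 0") (simp_all add: matrix_vector_mult_scaleR power2_eq_square field_simps)
  have "x /\<^sub>R norm x \<in> sphere 0 1" if "x \<noteq> 0" for x :: "real^'n"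
    using that by simp
  then have "?g s * (norm x)\<^sup>2 \<le> ?g x" "?g x \<le> ?g S * (norm x)\<^sup>2" for x
    using scale[of x] s(2)[of "x /\<^sub>R norm x"] S(2)[of "x /\<^sub>R norm x"]
    by (cases "x = 0"; simp add: mult.commute mult_left_mono)+
  with pos[OF s(1)] pos[OF S(1)] show ?thesis by (rule that)
qed

text \<open>Evaluates the blocks of the certificate matrices at a vector. The outer factors may
  differ, which covers the mixed term of \<open>Mmat\<close>.\<close>

lemma quadratic_form_transpose_mult:
  fixes A :: "real^'n^'m" and B :: "real^'k^'m" and C :: "real^'n^'k"
  shows "v \<bullet> ((transpose A ** B ** C) *v v) = (A *v v) \<bullet> (B *v (C *v v))"
  by (metis dot_lmul_matrix matrix_vector_mul_assoc vector_transpose_matrix)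

lemma quadratic_form_He: "v \<bullet> (He Y *v v) = 2 * (v \<bullet> (Y *v v))"
proof -
  have "v \<bullet> (transpose Y *v v) = v \<bullet> (Y *v v)"
    by (metis dot_lmul_matrix inner_commute transpose_matrix_vector)
  then show ?thesis by (simp add: He_def matrix_vector_mult_add_rdistrib inner_add_right)
qed

definition stack :: "real^'a \<Rightarrow> real^'b \<Rightarrow> real^('a + 'b)" where
  "stack x y = (\<chi> k. case k of Inl i \<Rightarrow> x $ i | Inr j \<Rightarrow> y $ j)"

lemma hcat_mult_stack:
  fixes x :: "real^'a::finite" and y :: "real^'b::finite"
  shows "hcat A B *v stack x y = A *v x + B *v y"
  by (simp add: hcat_def stack_def matrix_vector_mult_def vec_eq_iff sum.Plus
      flip: UNIV_Plus_UNIV)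

lemma diagonal_mult_vector_nth:
  assumes "diagonal D"
  shows "(D *v x) $ i = D $ i $ i * x $ i"
proof -
  have "(D *v x) $ i = (\<Sum>j\<in>UNIV. if j = i then D $ i $ i * x $ i else 0)"
    using assms unfolding matrix_vector_mult_def diagonal_def vec_lambda_beta
    by (intro sum.cong) auto
  then show ?thesis by simp
qed

text \<open>
  The quadratic form of \<open>M\<^sub>\<Lambda>\<close> at \<open>(x, \<eta>)\<close> is
  \<open>2 \<Sum>\<^sub>i \<Lambda>\<^sub>i (\<eta>\<^sub>i - m\<^sub>i z\<^sub>i)(M\<^sub>i z\<^sub>i - \<eta>\<^sub>i)\<close>, where \<open>z\<close> is the input of \<open>\<phi>\<close> and \<open>m\<^sub>i\<close>, \<open>M\<^sub>i\<close> are the sector bounds.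
\<close>

lemma Mmat_quadratic_form_nonneg:
  fixes x :: "real^'n" and \<eta> :: "real^'q"
  assumes sec: "static_sector \<phi> f D0 D1" and acts: "acts_componentwise \<phi> f"
    and L: "diagonal L" "0 \<preceq>\<^sub>L L"
    and \<eta>: "\<eta> = \<phi> (W *v \<eta> + U *v (Cp *v x))"
  shows "0 \<le> stack x \<eta> \<bullet> (Mmat Cp W U D0 D1 L *v stack x \<eta>)"
proof -
  define z where "z = W *v \<eta> + U *v (Cp *v x)"
  have Z: "Zmat Cp W U *v stack x \<eta> = z"
    by (simp add: Zmat_def hcat_mult_stack z_def matrix_vector_mul_assoc add.commute)
  have H: "Hmat *v stack x \<eta> = \<eta>"
    by (simp add: Hmat_def hcat_mult_stack)
  have D: "diagonal D0" "diagonal D1" using sec by (auto simp: static_sector_def)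
  have L_nonneg: "0 \<le> L $ i $ i" for i
  proof -
    \<comment> \<open>Testing the form on a unit vector isolates the diagonal entry.\<close>
    have "0 \<le> axis i 1 \<bullet> (L *v axis i 1)"
      using L(2) by (simp add: loewner_le_def pos_semidef_def)
    then show ?thesis by (simp add: inner_axis' diagonal_mult_vector_nth[OF L(1)])
  qed
  have "stack x \<eta> \<bullet> (Mmat Cp W U D0 D1 L *v stack x \<eta>)
      = - 2 * (z \<bullet> (D0 *v (L *v (D1 *v z)))) + 2 * (\<eta> \<bullet> (L *v ((D0 + D1) *v z)))
        - 2 * (\<eta> \<bullet> (L *v \<eta>))"
    using quadratic_form_transpose_mult[of "stack x \<eta>" "Zmat Cp W U" "D0 ** L ** D1" "Zmat Cp W U"]
      quadratic_form_transpose_mult[of "stack x \<eta>" Hmat "L ** (D0 + D1)" "Zmat Cp W U"]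
      quadratic_form_transpose_mult[of "stack x \<eta>" Hmat L "Hmat"]
    by (simp add: Mmat_def Let_def matrix_vector_mult_add_rdistrib matrix_vector_mult_diff_rdistrib
        inner_add_right inner_diff_right quadratic_form_He Z H matrix_mul_assoc
        flip: scaleR_matrix_vector_assoc matrix_vector_mul_assoc)
  \<comment> \<open>Diagonal matrices reduce the three forms to scalar sums, which combine by
    \<open>(\<eta> - m z) (M z - \<eta>) = - m M z^2 + (m + M) z \<eta> - \<eta>^2\<close>.\<close>
  also have "\<dots> = (\<Sum>i\<in>UNIV. 2 * L $ i $ i *
      ((\<eta> $ i - D0 $ i $ i * z $ i) * (D1 $ i $ i * z $ i - \<eta> $ i)))"
    by (simp add: inner_vec_def matrix_vector_mult_add_rdistrib diagonal_mult_vector_nth D L(1)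
        sum_distrib_left algebra_simps flip: sum.distrib sum_subtractf sum_negf)
  also have "0 \<le> \<dots>"
  proof (rule sum_nonneg)
    fix i
    have "\<eta> $ i = f i (z $ i)"
      using acts \<eta> by (metis acts_componentwise_def z_def)
    then have "0 \<le> (\<eta> $ i - D0 $ i $ i * z $ i) * (D1 $ i $ i * z $ i - \<eta> $ i)"
      using sec by (auto simp: static_sector_def)
    then show "0 \<le> 2 * L $ i $ i *
        ((\<eta> $ i - D0 $ i $ i * z $ i) * (D1 $ i $ i * z $ i - \<eta> $ i))"
      using L_nonneg[of i] by simp
  qed
  finally show ?thesis .
qed

lemma loewner_le_zeroD: "A \<preceq>\<^sub>L 0 \<Longrightarrow> v \<bullet> (A *v v) \<le> 0"
  using matrix_vector_mult_diff_rdistrib[of 0 A v]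
  by (simp add: loewner_le_def pos_semidef_def) (metis inner_minus_right neg_0_le_iff_le)

text \<open>For zero offsets, \<open>Xmat\<close>, \<open>Fmat\<close> and \<open>Gmat\<close>
  recover the state, its successor and the control from the stacked vector.\<close>

lemma Xmat_mult_stack: "Xmat *v stack x \<eta> = x"
  by (simp add: Xmat_def hcat_mult_stack)

lemma Fmat_mult_stack:
  "Fmat Ap Bp Cp V K *v stack x \<eta> = Ap *v x + Bp *v (K *v (Cp *v x) + V *v \<eta>)"
  by (simp add: Fmat_def hcat_mult_stack matrix_vector_mult_add_rdistrib matrix_vector_right_distrib
      matrix_vector_mul_assoc matrix_mul_assoc add.assoc)

lemma Gmat_mult_stack: "Gmat Cp V K *v stack x \<eta> = K *v (Cp *v x) + V *v \<eta>"
  by (simp add: Gmat_def hcat_mult_stack matrix_vector_mul_assoc)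

section \<open>Dissipation\<close>

text \<open>Iterating the one-step contraction gives the decay of the form; comparing the form with
  the squared norm from both sides gives decay of the norm.\<close>

lemma exponentially_stabilizing_if_decay:
  assumes P: "pos_def P" and \<rho>: "0 \<le> \<rho>" "\<rho> < 1"
    and step: "\<And>x u y \<eta> k. closed_loop Ap Bp Cp \<phi> W U V K b d x u y \<eta> \<Longrightarrow>
      x (Suc k) \<bullet> (P *v x (Suc k)) \<le> \<rho>\<^sup>2 * (x k \<bullet> (P *v x k))"
  shows "exponentially_stabilizing Ap Bp Cp \<phi> W U V K b d P \<rho>"
proof -
  have decay: "x k \<bullet> (P *v x k) \<le> \<rho> ^ (2 * k) * (x 0 \<bullet> (P *v x 0))"
    if cl: "closed_loop Ap Bp Cp \<phi> W U V K b d x u y \<eta>" for x u y \<eta> k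
  \<comment> \<open>The base case is an equality even for \<open>\<rho> = 0\<close>, because
    \<open>0 ^ 0 = 1\<close>.\<close>
  proof (induction k)
    case (Suc k)
    have "x (Suc k) \<bullet> (P *v x (Suc k)) \<le> \<rho>\<^sup>2 * (x k \<bullet> (P *v x k))" by (rule step[OF cl])
    also have "\<dots> \<le> \<rho>\<^sup>2 * (\<rho> ^ (2 * k) * (x 0 \<bullet> (P *v x 0)))"
      by (intro mult_left_mono Suc.IH) auto
    finally show ?case by (simp add: power_add power2_eq_square mult.assoc)
  qed simp
  obtain a B where a: "0 < a" "\<And>x. a * (norm x)\<^sup>2 \<le> x \<bullet> (P *v x)"
    and B: "0 < B" "\<And>x. x \<bullet> (P *v x) \<le> B * (norm x)\<^sup>2"
    using pos_def_bounds[OF P] by metis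
  \<comment> \<open>The constant is the square root of the ratio of the two form bounds, since the
    comparison is made between squares.\<close>
  have "norm (x k) \<le> sqrt (B / a) * \<rho> ^ k * norm (x 0)"
    if cl: "closed_loop Ap Bp Cp \<phi> W U V K b d x u y \<eta>" for x u y \<eta> k
  proof (rule power2_le_imp_le)
    have "a * (norm (x k))\<^sup>2 \<le> \<rho> ^ (2 * k) * (x 0 \<bullet> (P *v x 0))"
      using a(2) decay[OF cl] by (rule order_trans)
    also have "\<dots> \<le> \<rho> ^ (2 * k) * (B * (norm (x 0))\<^sup>2)"
      by (intro mult_left_mono B(2)) (use \<rho> in auto)
    finally have "(norm (x k))\<^sup>2 \<le> B / a * \<rho> ^ (2 * k) * (norm (x 0))\<^sup>2"
      using a(1) by (simp add: field_simps)
    also have "\<dots> = (sqrt (B / a) * \<rho> ^ k * norm (x 0))\<^sup>2"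
      using a(1) B(1) by (simp add: power_mult_distrib real_sqrt_pow2 mult.commute flip: power_mult)
    finally show "(norm (x k))\<^sup>2 \<le> (sqrt (B / a) * \<rho> ^ k * norm (x 0))\<^sup>2" .
    show "0 \<le> sqrt (B / a) * \<rho> ^ k * norm (x 0)"
      using a(1) B(1) \<rho> by simp
  qed
  then show ?thesis
    unfolding exponentially_stabilizing_def using decay \<rho> a(1) B(1)
    by (intro conjI exI[of _ "sqrt (B / a)"] exI[of _ \<rho>]) auto
qed

text \<open>Weighting the \<open>k\<close>-th inequality by \<open>\<beta> ^ k\<close> makes the
  storage terms telescope. The remaining term is nonnegative, so the partial sums of a nonnegative
  series stay below \<open>S 0\<close>.\<close>

lemma summable_discounted_if_dissipative:
  fixes s S :: "nat \<Rightarrow> real"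
  assumes s: "\<And>k. 0 \<le> s k" and S: "\<And>k. 0 \<le> S k" and \<beta>: "0 < \<beta>"
    and step: "\<And>k. \<beta> * S (Suc k) - S k + s k \<le> 0"
  shows "summable (\<lambda>k. \<beta> ^ k * s k)" "(\<Sum>k. \<beta> ^ k * s k) \<le> S 0"
proof -
  have "(\<Sum>k<N. \<beta> ^ k * s k) \<le> S 0 - \<beta> ^ N * S N" for N
  proof (induction N)
    case (Suc N)
    have "\<beta> ^ N * (\<beta> * S (Suc N) - S N + s N) \<le> 0"
      using step[of N] \<beta> by (simp add: mult_nonneg_nonpos)
    with Suc show ?case by (simp add: algebra_simps)
  qed simp
  moreover have "0 \<le> \<beta> ^ N * S N" for N using S \<beta> by simp
  ultimately have bound: "(\<Sum>k<N. \<beta> ^ k * s k) \<le> S 0" for N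
    by (smt (verit))
  show "summable (\<lambda>k. \<beta> ^ k * s k)"
    by (rule summableI_nonneg_bounded[OF _ bound]) (use s \<beta> in simp)
  then show "(\<Sum>k. \<beta> ^ k * s k) \<le> S 0"
    using bound by (intro suminf_le_const)
qed

text \<open>The parameters are arbitrary, which expresses independence of the optimizer. Zero
  offsets are assumed for stability and performance because, for instance,
  \<open>Bp *v d \<noteq> 0\<close> with \<open>b = 0\<close> drives the state away from the
  origin.\<close>

theorem proposition3:
  fixes Ap :: "real^'n^'n" and Bp :: "real^'m^'n" and Cp :: "real^'n^'p"
    and W :: "real^'q^'q" and U :: "real^'p^'q" and V :: "real^'q^'m" and K :: "real^'p^'m"
    and b :: "real^'q" and d :: "real^'m"
    and \<phi> :: "real^'q \<Rightarrow> real^'q" and f :: "'q \<Rightarrow> real \<Rightarrow> real"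
    and D0 D1 :: "real^'q^'q"
  assumes "componentwise_nonexpansive \<phi> f"
    and "static_sector \<phi> f D0 D1"
    and "spectral_radius \<bar>W\<bar> < 1"
  shows
    "(\<forall>(P::real^'n^'n) (\<Lambda>::real^'q^'q) (\<rho>::real).
        pos_def P \<and> diagonal \<Lambda> \<and> 0 \<preceq>\<^sub>L \<Lambda> \<and> 0 \<le> \<rho> \<and> \<rho> < 1 \<and>
        transpose (Fmat Ap Bp Cp V K) ** P ** Fmat Ap Bp Cp V K
          - \<rho>\<^sup>2 *\<^sub>R (transpose Xmat ** P ** Xmat)
          + Mmat Cp W U D0 D1 \<Lambda> \<preceq>\<^sub>L 0 \<longrightarrow>
        well_posed \<phi> W \<and>
        (b = 0 \<and> d = 0 \<longrightarrow> exponentially_stabilizing Ap Bp Cp \<phi> W U V K b d P \<rho>)) \<and>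
     (\<forall>(Q::real^'n^'n) (R::real^'m^'m) (\<beta>::real) (P::real^'n^'n) (\<Lambda>::real^'q^'q).
        0 \<preceq>\<^sub>L Q \<and> 0 \<preceq>\<^sub>L R \<and> 0 < \<beta> \<and> \<beta> \<le> 1 \<and>
        pos_def P \<and> diagonal \<Lambda> \<and> 0 \<preceq>\<^sub>L \<Lambda> \<and>
        \<beta> *\<^sub>R (transpose (Fmat Ap Bp Cp V K) ** P ** Fmat Ap Bp Cp V K)
          - transpose Xmat ** P ** Xmat
          + transpose Xmat ** Q ** Xmat
          + transpose (Gmat Cp V K) ** R ** Gmat Cp V K
          + Mmat Cp W U D0 D1 \<Lambda> \<preceq>\<^sub>L 0 \<longrightarrow>
        well_posed \<phi> W \<and>
        (b = 0 \<and> d = 0 \<longrightarrow> discounted_performance Ap Bp Cp \<phi> W U V K b d Q R \<beta> P))"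
proof -
  have acts: "acts_componentwise \<phi> f"
    using assms(1) by (simp add: componentwise_nonexpansive_def)
  show ?thesis
  proof (intro conjI allI impI; (elim conjE)?)
    show "well_posed \<phi> W" "well_posed \<phi> W"
      using well_posed_if_spectral_radius_less_one[OF assms(1,3)] by auto
  next
    fix P :: "real^'n^'n" and \<Lambda> :: "real^'q^'q" and \<rho> :: real
    assume P: "pos_def P" and \<rho>: "0 \<le> \<rho>" "\<rho> < 1" and \<Lambda>: "diagonal \<Lambda>" "0 \<preceq>\<^sub>L \<Lambda>"
      and lmi: "transpose (Fmat Ap Bp Cp V K) ** P ** Fmat Ap Bp Cp V K
            - \<rho>\<^sup>2 *\<^sub>R (transpose Xmat ** P ** Xmat) + Mmat Cp W U D0 D1 \<Lambda> \<preceq>\<^sub>L 0"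
      and bd: "b = 0" "d = 0"
    show "exponentially_stabilizing Ap Bp Cp \<phi> W U V K b d P \<rho>"
    proof (rule exponentially_stabilizing_if_decay[OF P \<rho>])
      fix x u y \<eta> k
      assume "closed_loop Ap Bp Cp \<phi> W U V K b d x u y \<eta>"
      then have loop: "x (Suc k) = Fmat Ap Bp Cp V K *v stack (x k) (\<eta> k)"
        "\<eta> k = \<phi> (W *v \<eta> k + U *v (Cp *v x k))"
        unfolding Fmat_mult_stack closed_loop_def bd by (metis add.right_neutral)+
      \<comment> \<open>At the stacked vector the matrix inequality bounds the storage difference
        plus the form of \<open>Mmat\<close> by 0, and that form is nonnegative by the sector
        condition.\<close>
      show "x (Suc k) \<bullet> (P *v x (Suc k)) \<le> \<rho>\<^sup>2 * (x k \<bullet> (P *v x k))"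
        using loewner_le_zeroD[OF lmi, of "stack (x k) (\<eta> k)"]
          Mmat_quadratic_form_nonneg[OF assms(2) acts \<Lambda> loop(2)]
        by (simp add: matrix_vector_mult_add_rdistrib matrix_vector_mult_diff_rdistrib inner_add_right
            inner_diff_right quadratic_form_transpose_mult Xmat_mult_stack loop(1)
            flip: scaleR_matrix_vector_assoc)
    qed
  next
    fix Q P :: "real^'n^'n" and R :: "real^'m^'m" and \<beta> :: real and \<Lambda> :: "real^'q^'q"
    assume Q: "0 \<preceq>\<^sub>L Q" and R: "0 \<preceq>\<^sub>L R" and \<beta>: "0 < \<beta>" "\<beta> \<le> 1"
      and P: "pos_def P" and \<Lambda>: "diagonal \<Lambda>" "0 \<preceq>\<^sub>L \<Lambda>"
      and lmi: "\<beta> *\<^sub>R (transpose (Fmat Ap Bp Cp V K) ** P ** Fmat Ap Bp Cp V K)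
            - transpose Xmat ** P ** Xmat + transpose Xmat ** Q ** Xmat
            + transpose (Gmat Cp V K) ** R ** Gmat Cp V K + Mmat Cp W U D0 D1 \<Lambda> \<preceq>\<^sub>L 0"
      and bd: "b = 0" "d = 0"
    show "discounted_performance Ap Bp Cp \<phi> W U V K b d Q R \<beta> P"
      unfolding discounted_performance_def
    proof (intro allI impI)
      fix x u y \<eta>
      assume cl: "closed_loop Ap Bp Cp \<phi> W U V K b d x u y \<eta>"
      let ?s = "\<lambda>k. x k \<bullet> (Q *v x k) + u k \<bullet> (R *v u k)" and ?S = "\<lambda>k. x k \<bullet> (P *v x k)"
      have s_nonneg: "0 \<le> ?s k" for k
        using Q R by (simp add: loewner_le_def pos_semidef_def)
      have S_nonneg: "0 \<le> ?S k" for k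
        \<comment> \<open>The zero state is separate because \<open>pos_def\<close> speaks only of
          nonzero vectors.\<close>
        using P by (cases "x k = 0") (auto simp: pos_def_def less_imp_le)
      have step: "\<beta> * ?S (Suc k) - ?S k + ?s k \<le> 0" for k
      proof -
        have loop: "x (Suc k) = Fmat Ap Bp Cp V K *v stack (x k) (\<eta> k)"
          "u k = Gmat Cp V K *v stack (x k) (\<eta> k)"
          "\<eta> k = \<phi> (W *v \<eta> k + U *v (Cp *v x k))"
          using cl unfolding Fmat_mult_stack Gmat_mult_stack closed_loop_def bd
          by (metis add.right_neutral)+
        show ?thesis
          using loewner_le_zeroD[OF lmi, of "stack (x k) (\<eta> k)"]
            Mmat_quadratic_form_nonneg[OF assms(2) acts \<Lambda> loop(3)]
          by (simp add: matrix_vector_mult_add_rdistrib matrix_vector_mult_diff_rdistrib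
              inner_add_right inner_diff_right quadratic_form_transpose_mult Xmat_mult_stack loop(1,2)
              flip: scaleR_matrix_vector_assoc)
      qed
      show "summable (\<lambda>k. \<beta> ^ k * ?s k) \<and> (\<Sum>k. \<beta> ^ k * ?s k) \<le> ?S 0"
        using summable_discounted_if_dissipative[of ?s ?S, OF s_nonneg S_nonneg \<beta>(1) step] by simp
    qed
  qed
qed

end
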